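(* Let $G$ be an infinite group. (1) Let $W$ be a left or right translate (i.e. $W=gH$ or $W=Hg$ for some $g\in G$) of an infinite subgroup $H$ of $G$. Then every asymptotic complement of $W$ in $G$ contains a minimal asymptotic complement of $W$. (2) Let $W\subseteq G$ be such that $G\setminus W$ is infinite and $W$ contains an infinite subgroup of $G$ of finite index in $G$. Then $W$ admits a minimal asymptotic complement and a minimal complement in $G$. In particular, the union of a nonzero subgroup of $\mathbb{Z}$ and a finite subset of $\mathbb{Z}$ admits a minimal asymptotic complement in $\mathbb{Z}$.
   Context: For nonempty subsets $A,B$ of a group $G$, $AB=\{ab : a\in A, b\in B\}$ (written $A+B$ in additive groups such as $\mathbb{Z}$). Given nonempty $W,C\subseteq G$: $C$ is a complement to $W$ if $WC=G$; $C$ is a minimal complement to $W$ if $C$ is a complement to $W$ but $C\setminus\{c\}$ is not a complement to $W$ for every $c\in C$. $C$ is an asymptotic complement to $W$ if there is a finite subset $F\subseteq G$ with $WC=G\setminus F$; $C$ is a minimal asymptotic complement to $W$ if $C$ is an asymptotic complement to $W$ but $C\setminus\{c\}$ is not an asymptotic complement to $W$ for every $c\in C$. *)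

theory Defs
  imports "HOL-Algebra.Algebra"
begin

definition is_complement :: "('a, 'b) monoid_scheme \<Rightarrow> 'a set \<Rightarrow> 'a set \<Rightarrow> bool"
  where "is_complement G W C \<longleftrightarrow>
    W \<subseteq> carrier G \<and> W \<noteq> {} \<and> C \<subseteq> carrier G \<and> C \<noteq> {} \<and>
    W <#>\<^bsub>G\<^esub> C = carrier G"

definition is_minimal_complement :: "('a, 'b) monoid_scheme \<Rightarrow> 'a set \<Rightarrow> 'a set \<Rightarrow> bool"
  where "is_minimal_complement G W C \<longleftrightarrow>
    is_complement G W C \<and> (\<forall>c\<in>C. \<not> is_complement G W (C - {c}))"

definition is_asymptotic_complement :: "('a, 'b) monoid_scheme \<Rightarrow> 'a set \<Rightarrow> 'a set \<Rightarrow> bool"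
  where "is_asymptotic_complement G W C \<longleftrightarrow>
    W \<subseteq> carrier G \<and> W \<noteq> {} \<and> C \<subseteq> carrier G \<and> C \<noteq> {} \<and>
    (\<exists>F. finite F \<and> F \<subseteq> carrier G \<and> W <#>\<^bsub>G\<^esub> C = carrier G - F)"

definition is_minimal_asymptotic_complement ::
    "('a, 'b) monoid_scheme \<Rightarrow> 'a set \<Rightarrow> 'a set \<Rightarrow> bool"
  where "is_minimal_asymptotic_complement G W C \<longleftrightarrow>
    is_asymptotic_complement G W C \<and>
    (\<forall>c\<in>C. \<not> is_asymptotic_complement G W (C - {c}))"

end

theory Submission
  imports Defs
begin

text \<open>
  If \<open>W\<close> is a translate of a subgroup, the sets \<open>Wc\<close> are pairwise equal or disjoint. Keeping one
  \<open>c\<close> from each class of an asymptotic complement preserves the product with \<open>W\<close>, and deleting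
  a further element \<open>c\<close> uncovers the infinite set \<open>Wc\<close>. In the second part, coset representatives
  form a finite complement to \<open>W\<close>, and any property of a finite set descends to a subset from
  which no single element can be deleted.
\<close>

text \<open>Single elements are deleted as long as \<open>P\<close> survives, and finiteness ends
  the process. This suffices because both notions of minimality in play concern the deletion of one
  element only.\<close>

lemma finite_subset_minimal_for_deletion:
  assumes "finite C" and "P C"
  shows "\<exists>M\<subseteq>C. P M \<and> (\<forall>c\<in>M. \<not> P (M - {c}))"
  using assms
proof (induction C rule: finite_psubset_induct)
  case (psubset C)
  show ?case
  proof (cases "\<exists>c\<in>C. P (C - {c})")
    case True
    then obtain c where c: "c \<in> C" "P (C - {c})" ..
    then have "C - {c} \<subset> C"
      by auto
    from psubset.IH[OF this c(2)] show ?thesis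
      by (meson Diff_subset order_trans)
  next
    case False
    with psubset.prems show ?thesis
      by (intro exI[of _ C]) simp
  qed
qed

lemma is_complement_imp_asymptotic:
  "is_complement G W C \<Longrightarrow> is_asymptotic_complement G W C"
  unfolding is_complement_def is_asymptotic_complement_def
  by (auto intro: exI[of _ "{}"])

lemma finite_complement_imp_minimal:
  assumes "is_complement G W C" and "finite C"
  shows "\<exists>M. is_minimal_asymptotic_complement G W M" and "\<exists>M. is_minimal_complement G W M"
  unfolding is_minimal_asymptotic_complement_def is_minimal_complement_def
  using finite_subset_minimal_for_deletion[of C "is_asymptotic_complement G W",
      OF assms(2) is_complement_imp_asymptotic[OF assms(1)]]
    finite_subset_minimal_for_deletion[of C "is_complement G W", OF assms(2,1)]
  by metis+

text \<open>Transfers a complement from a subgroup to any larger set: the product can only grow, and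
  it already fills the group.\<close>

lemma is_complement_mono:
  assumes "group G" and "is_complement G V C" and "V \<subseteq> W" and "W \<subseteq> carrier G"
  shows "is_complement G W C"
proof -
  have "V <#>\<^bsub>G\<^esub> C \<subseteq> W <#>\<^bsub>G\<^esub> C" and "W <#>\<^bsub>G\<^esub> C \<subseteq> carrier G"
    using assms mono_set_mult[of V W C C G] monoid.set_mult_closed[OF group.is_monoid[OF assms(1)]]
    by (auto simp: is_complement_def)
  with assms show ?thesis
    by (auto simp: is_complement_def)
qed

text \<open>Seen this way, a product with \<open>W\<close> depends only on the family of translates
  \<open>W #> c\<close>, so elements giving the same translate are interchangeable.\<close>

lemma (in group) set_mult_eq_UN_r_coset: "A <#> B = (\<Union>b\<in>B. A #> b)"
  by (auto simp: set_mult_def r_coset_def)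

lemma (in group) finite_index_imp_finite_complement:
  assumes "subgroup H G" and "finite (rcosets H)"
  shows "\<exists>R. finite R \<and> is_complement G H R"
proof -
  interpret H: subgroup H G by fact
  have "\<forall>K\<in>rcosets H. \<exists>x. x \<in> carrier G \<and> K = H #> x"
    by (auto simp: RCOSETS_def)
  then obtain r where r: "\<And>K. K \<in> rcosets H \<Longrightarrow> r K \<in> carrier G \<and> K = H #> r K"
    by metis
  have "H <#> r ` (rcosets H) = \<Union>(rcosets H)"
    using r by (auto simp: set_mult_eq_UN_r_coset)
  also have "\<dots> = carrier G"
    using rcosets_part_G[OF assms(1)] .
  finally have "H <#> r ` (rcosets H) = carrier G" .
  moreover have "r ` (rcosets H) \<noteq> {}"
    using rcosetsI[OF H.subset one_closed] by blast
  moreover have "H \<noteq> {}"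
    using H.one_closed by blast
  ultimately have "is_complement G H (r ` (rcosets H))"
    using r H.subset by (auto simp: is_complement_def)
  then show ?thesis
    using assms(2) by blast
qed

text \<open>Both cases reduce to the partition into right cosets of \<open>H\<close>. For W = Hg,
  the translate Wa is the coset H(ga). For W = gH, it is g(Ha), and left multiplication by g
  preserves disjointness by cancellation.\<close>

lemma (in group) subgroup_translate_r_cosets_disjoint:
  assumes "subgroup H G" and "g \<in> carrier G" and "W = g <# H \<or> W = H #> g"
    and "a \<in> carrier G" and "b \<in> carrier G"
  shows "W #> a = W #> b \<or> (W #> a) \<inter> (W #> b) = {}"
proof -
  have H: "H \<subseteq> carrier G"
    using assms(1) by (rule subgroup.subset)
  have cosets: "H #> x = H #> y \<or> (H #> x) \<inter> (H #> y) = {}"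
    if "x \<in> carrier G" "y \<in> carrier G" for x y
    using pairwiseD[OF rcos_disjoint[OF assms(1)] rcosetsI[OF H that(1)] rcosetsI[OF H that(2)]]
    unfolding disjnt_def by blast
  show ?thesis
    using assms(3)
  proof
    assume W: "W = g <# H"
    have eq: "W #> x = g <# (H #> x)" if "x \<in> carrier G" for x
      using that assms(2) H by (simp add: W coset_assoc)
    have disj: "(g <# A) \<inter> (g <# B) = {}"
      if "A \<inter> B = {}" "A \<subseteq> carrier G" "B \<subseteq> carrier G" for A B
      using that assms(2) by (fastforce simp: l_coset_def)
    show ?thesis
      using cosets[OF assms(4,5)] disj[OF _ r_coset_subset_G[OF H assms(4)] r_coset_subset_G[OF H assms(5)]]
      unfolding eq[OF assms(4)] eq[OF assms(5)] by metis
  next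
    assume W: "W = H #> g"
    show ?thesis
      using cosets[of "g \<otimes> a" "g \<otimes> b"] assms(2,4,5) H by (simp add: W coset_mult_assoc)
  qed
qed

lemma (in group) disjoint_translates_imp_minimal_asymptotic:
  assumes "infinite W"
    and disj: "\<And>a b. a \<in> carrier G \<Longrightarrow> b \<in> carrier G \<Longrightarrow>
      W #> a = W #> b \<or> (W #> a) \<inter> (W #> b) = {}"
    and C: "is_asymptotic_complement G W C"
  shows "\<exists>M\<subseteq>C. is_minimal_asymptotic_complement G W M"
proof -
  have sub: "W \<subseteq> carrier G" "C \<subseteq> carrier G"
    using C by (auto simp: is_asymptotic_complement_def)
  \<comment> \<open>\<open>M\<close> is a transversal in \<open>C\<close> for the relation of giving
    the same translate of \<open>W\<close>.\<close>
  obtain M where M: "M \<subseteq> C" "inj_on ((#>) W) M" "(#>) W ` C = (#>) W ` M"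
    by (meson subset_image_inj order_refl)
  have WM: "W <#> M = W <#> C"
    using M(3) by (simp add: set_mult_eq_UN_r_coset)
  have "M \<noteq> {}"
    using M(3) C by (auto simp: is_asymptotic_complement_def)
  with C M(1) WM have asym: "is_asymptotic_complement G W M"
    by (auto simp: is_asymptotic_complement_def)
  have "\<not> is_asymptotic_complement G W (M - {c})" if c: "c \<in> M" for c
  proof
    assume "is_asymptotic_complement G W (M - {c})"
    then obtain F where F: "finite F" "W <#> (M - {c}) = carrier G - F"
      by (auto simp: is_asymptotic_complement_def)
    have cG: "c \<in> carrier G"
      using c M(1) sub by blast
    \<comment> \<open>Injectivity on \<open>M\<close> rules out the equality alternative of
      \<open>disj\<close>.\<close>
    have "(W #> c) \<inter> (W #> b) = {}" if "b \<in> M - {c}" for b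
    proof -
      have "W #> c \<noteq> W #> b"
        using inj_onD[OF M(2), of c b] c that by blast
      then show ?thesis
        using disj[OF cG] M(1) sub(2) that by blast
    qed
    then have "(W #> c) \<inter> (W <#> (M - {c})) = {}"
      by (auto simp: set_mult_eq_UN_r_coset)
    moreover have "W #> c \<subseteq> carrier G"
      using r_coset_subset_G[OF sub(1) cG] .
    \<comment> \<open>The translate by \<open>c\<close> avoids a set that misses only
      \<open>F\<close>, so it fits inside the finite \<open>F\<close>; yet right multiplication by
      \<open>c\<close> is injective on the infinite \<open>W\<close>.\<close>
    ultimately have "W #> c \<subseteq> F"
      using F(2) by blast
    then have "finite (W #> c)"
      using F(1) by (rule finite_subset)
    moreover have "W #> c = (\<lambda>w. w \<otimes> c) ` W"
      by (auto simp: r_coset_def)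
    moreover have "inj_on (\<lambda>w. w \<otimes> c) W"
      using sub(1) cG by (auto simp: inj_on_def subset_iff)
    ultimately show False
      using assms(1) by (metis finite_imageD)
  qed
  with asym M(1) show ?thesis
    unfolding is_minimal_asymptotic_complement_def by metis
qed

lemma (in group) infinite_subgroup_translate:
  assumes "subgroup H G" and "infinite H" and "g \<in> carrier G" and "W = g <# H \<or> W = H #> g"
  shows "infinite W"
proof -
  have H: "H \<subseteq> carrier G"
    using assms(1) by (rule subgroup.subset)
  have "g <# H = (\<lambda>h. g \<otimes> h) ` H" "H #> g = (\<lambda>h. h \<otimes> g) ` H"
    by (auto simp: l_coset_def r_coset_def)
  moreover have "inj_on (\<lambda>h. g \<otimes> h) H" "inj_on (\<lambda>h. h \<otimes> g) H"
    using H assms(3) by (auto simp: inj_on_def subset_iff)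
  ultimately show ?thesis
    using assms(2,4) by (metis finite_imageD)
qed

text \<open>Division with remainder by a nonzero \<open>n\<close> in \<open>H\<close>: the quotient
  part is a multiple of \<open>n\<close>, hence in \<open>H\<close>, and only finitely many
  remainders occur.\<close>

lemma subgroup_integer_group_finite_complement:
  assumes "subgroup H integer_group" and "H \<noteq> {0}"
  shows "\<exists>C. finite C \<and> is_complement integer_group H C"
proof -
  interpret H: subgroup H integer_group by fact
  obtain n where n: "n \<in> H" "n \<noteq> 0"
    using assms(2) H.one_closed by auto
  \<comment> \<open>Multiples of \<open>n\<close> are its powers in the additive group.\<close>
  have mult: "k * n \<in> H" for k
    using group.subgroup_int_pow_closed[OF group_integer_group assms(1) n(1), of k]
    by simp
  let ?C = "range (\<lambda>x. x mod n)"
  \<comment> \<open>The interval is symmetric because \<open>n\<close> may be negative and the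
    remainder takes the sign of \<open>n\<close>.\<close>
  have "x mod n \<in> {- \<bar>n\<bar>..\<bar>n\<bar>}" for x
    using abs_mod_less[OF n(2), of x] by (simp add: abs_if split: if_splits)
  then have "finite ?C"
    by (intro finite_subset[OF image_subsetI finite_atLeastAtMost_int])
  moreover have "x div n * n + x mod n \<in> H <#>\<^bsub>integer_group\<^esub> ?C" for x
    using mult[of "x div n"] unfolding set_mult_def mult_integer_group by blast
  then have "is_complement integer_group H ?C"
    using H.one_closed by (auto simp: is_complement_def)
  ultimately show ?thesis
    by blast
qed

theorem theoremB:
  fixes G (structure)
  assumes "group G" and "infinite (carrier G)"
  shows
    "(\<forall>H g W. subgroup H G \<longrightarrow> infinite H \<longrightarrow> g \<in> carrier G \<longrightarrow>
        W = g <# H \<or> W = H #> g \<longrightarrow>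
        (\<forall>C. is_asymptotic_complement G W C \<longrightarrow>
          (\<exists>M. M \<subseteq> C \<and> is_minimal_asymptotic_complement G W M))) \<and>
     (\<forall>W. W \<subseteq> carrier G \<longrightarrow> infinite (carrier G - W) \<longrightarrow>
        (\<exists>H. subgroup H G \<and> infinite H \<and> finite (rcosets H) \<and> H \<subseteq> W) \<longrightarrow>
        (\<exists>C. is_minimal_asymptotic_complement G W C) \<and>
        (\<exists>C. is_minimal_complement G W C)) \<and>
     (\<forall>(H :: int set) F. subgroup H integer_group \<longrightarrow> H \<noteq> {0} \<longrightarrow> finite F \<longrightarrow>
        (\<exists>C. is_minimal_asymptotic_complement integer_group (H \<union> F) C))"
proof (rule conjI; (rule conjI)?; intro allI impI)
  interpret group G by fact
  fix H g W C
  assume H: "subgroup H G" "infinite H" "g \<in> carrier G" "W = g <# H \<or> W = H #> g"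
    and C: "is_asymptotic_complement G W C"
  show "\<exists>M. M \<subseteq> C \<and> is_minimal_asymptotic_complement G W M"
    by (rule disjoint_translates_imp_minimal_asymptotic[OF infinite_subgroup_translate[OF H]
          subgroup_translate_r_cosets_disjoint[OF H(1,3,4)] C])
next
  interpret group G by fact
  fix W
  assume W: "W \<subseteq> carrier G"
    and "\<exists>H. subgroup H G \<and> infinite H \<and> finite (rcosets H) \<and> H \<subseteq> W"
  then obtain H where H: "subgroup H G" "finite (rcosets H)" "H \<subseteq> W"
    by blast
  obtain R where R: "finite R" "is_complement G H R"
    using finite_index_imp_finite_complement[OF H(1,2)] by blast
  show "(\<exists>C. is_minimal_asymptotic_complement G W C) \<and> (\<exists>C. is_minimal_complement G W C)"
    using finite_complement_imp_minimal[OF is_complement_mono[OF assms(1) R(2) H(3) W] R(1)] ..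
next
  fix H F :: "int set"
  assume "subgroup H integer_group" "H \<noteq> {0}"
  then obtain C where C: "finite C" "is_complement integer_group H C"
    using subgroup_integer_group_finite_complement by blast
  \<comment> \<open>The union can be all of the integers, where the second claim says nothing, so
    the argument restarts from a finite complement to \<open>H\<close>.\<close>
  have "is_complement integer_group (H \<union> F) C"
    by (rule is_complement_mono[OF group_integer_group C(2)]) auto
  then show "\<exists>C. is_minimal_asymptotic_complement integer_group (H \<union> F) C"
    using C(1) by (rule finite_complement_imp_minimal(1))
qed

end
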